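(* Let $n \ge 2$, let $a_0,\dots,a_{n-1}\in\mathbb R$, let $f_s(x)=x^n+a_{n-1}x^{n-1}+\dots+a_1x+a_0$, and let $S$ be the set of all $X\in M_2(\mathbb R)$ such that $X^n+a_{n-1}\cdot X^{n-1}+\dots+a_1\cdot X+a_0\cdot I=O$. Then $S$ is the disjoint union of the following sets: (i) $S(D(p,p))$, where $p$ is a real root of $f_s(x)=0$; (ii) $S(J(p))$, where $p$ is a real root of $f_s(x)=0$ of multiplicity $\ge 2$; (iii) $S(D(p,q))$, where $p<q$ are real roots of $f_s(x)=0$; (iv) $S(R(a,b))$, where $a+ib$ with $b>0$ is a complex root of $f_s(x)=0$.
   Context: $M_2(\mathbb R)$ is the algebra of real $2\times2$ matrices, $GL_2(\mathbb R)$ the group of invertible ones, $I$ the identity matrix, $O$ the null matrix. For real $p,q$ put $D(p,q)=\begin{pmatrix}p&0\\0&q\end{pmatrix}$ and $J(p)=\begin{pmatrix}p&1\\0&p\end{pmatrix}$; for real $a,b$ with $a^2+b^2\ne0$ put $R(a,b)=\begin{pmatrix}a&b\\-b&a\end{pmatrix}$. For $B$ any of these matrices, $S(B)=\{X^{-1}BX : X\in GL_2(\mathbb R)\}$ denotes its real conjugacy class. *)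

theory Defs
  imports "HOL-Analysis.Analysis" "HOL-Computational_Algebra.Polynomial"
begin

(* The power operator inherited by real^2^2 from class power is componentwise,
   and so are * and 1; matrix powers are taken with respect to ** and mat 1. *)
primrec matrix_pow :: "real^2^2 \<Rightarrow> nat \<Rightarrow> real^2^2" where
  "matrix_pow X 0 = mat 1"
| "matrix_pow X (Suc k) = X ** matrix_pow X k"

(* Lists of lists are read row by row. *)
definition mat_D :: "real \<Rightarrow> real \<Rightarrow> real^2^2" where
  "mat_D p q = vector [vector [p, 0], vector [0, q]]"

definition mat_J :: "real \<Rightarrow> real^2^2" where
  "mat_J p = vector [vector [p, 1], vector [0, p]]"

definition mat_R :: "real \<Rightarrow> real \<Rightarrow> real^2^2" where
  "mat_R a b = vector [vector [a, b], vector [- b, a]]"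

definition conj_class :: "real^2^2 \<Rightarrow> (real^2^2) set" where
  "conj_class B = {matrix_inv X ** B ** X |X. invertible X}"

definition monic_poly :: "nat \<Rightarrow> (nat \<Rightarrow> real) \<Rightarrow> real poly" where
  "monic_poly n a = monom 1 n + (\<Sum>i<n. monom (a i) i)"

definition matrix_solutions :: "nat \<Rightarrow> (nat \<Rightarrow> real) \<Rightarrow> (real^2^2) set" where
  "matrix_solutions n a =
     {X. matrix_pow X n + (\<Sum>i<n. a i *\<^sub>R matrix_pow X i) = 0}"

(* The conjugacy classes in the decomposition are indexed by their representative
   matrices. The next lemmas show that distinct parameters always give distinct
   representatives, within one type and across the four types, so disjointness of the
   family indexed by matrices is disjointness over all types and parameters. *)
lemma mat_inject:
  "mat_D p q = mat_D p' q' \<longleftrightarrow> p = p' \<and> q = q'"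
  "mat_J p = mat_J p' \<longleftrightarrow> p = p'"
  "mat_R a b = mat_R a' b' \<longleftrightarrow> a = a' \<and> b = b'"
  by (auto simp: mat_D_def mat_J_def mat_R_def vec_eq_iff forall_2)

lemma mat_distinct:
  "mat_D p q \<noteq> mat_J r"
  "b > 0 \<Longrightarrow> mat_D p q \<noteq> mat_R a b"
  "b > 0 \<Longrightarrow> mat_J r \<noteq> mat_R a b"
  by (auto simp: mat_D_def mat_J_def mat_R_def vec_eq_iff forall_2)

end

theory Submission
  imports Defs
begin

text \<open>
  Two facts carry the proof.

  The first is a classification of \<open>2 \<times> 2\<close> matrices up to conjugacy. A matrix \<open>X\<close> that is not
  scalar has a cyclic row vector \<open>v\<close>: \<open>v\<close> and \<open>v X\<close> are linearly independent. By Cayley--Hamilton,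
  \<open>X\<close> acts on the basis \<open>v\<close>, \<open>v X\<close> by a companion matrix that depends only on the trace and the
  determinant of \<open>X\<close>. Hence two non-scalar matrices are conjugate as soon as these two numbers
  agree (\<open>conj_class_nonscalar\<close>), while a scalar matrix is conjugate to itself only. The sign of
  the discriminant \<open>trace\<^sup>2 - 4 det\<close> tells which of the representatives \<open>D(p,q)\<close> with \<open>p < q\<close>,
  \<open>J(p)\<close>, \<open>R(u,v)\<close> with \<open>v > 0\<close> has the trace and determinant of a given non-scalar matrix,
  and trace and determinant then determine the parameters. So, together with the scalar
  matrices, the representatives meet every conjugacy class exactly once.

  The second is that the value of a polynomial \<open>f\<close> at a matrix is compatible with conjugation,
  so that being annihilated by \<open>f\<close> only has to be tested on the representatives. Their powers are
  explicit, and \<open>f\<close> takes at \<open>D(p,q)\<close>, \<open>J(p)\<close> and \<open>R(u,v)\<close> values built from \<open>f(p)\<close> and \<open>f(q)\<close>,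
  from \<open>f(p)\<close> and \<open>f'(p)\<close>, and from the real and imaginary parts of \<open>f(u + iv)\<close>, respectively
  (\<open>matrix_poly_mat_D\<close>, \<open>matrix_poly_mat_J\<close>, \<open>matrix_poly_mat_R\<close>).
\<close>

section \<open>Conjugacy of real two by two matrices\<close>

lemma mat_entries [simp]:
  "mat_D p q $ 1 $ 1 = p" "mat_D p q $ 1 $ 2 = 0" "mat_D p q $ 2 $ 1 = 0" "mat_D p q $ 2 $ 2 = q"
  "mat_J p $ 1 $ 1 = p" "mat_J p $ 1 $ 2 = 1" "mat_J p $ 2 $ 1 = 0" "mat_J p $ 2 $ 2 = p"
  "mat_R u v $ 1 $ 1 = u" "mat_R u v $ 1 $ 2 = v" "mat_R u v $ 2 $ 1 = - v" "mat_R u v $ 2 $ 2 = u"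
  by (simp_all add: mat_D_def mat_J_def mat_R_def)

lemma matrix_eq_2: "X = Y \<longleftrightarrow> X $ 1 $ 1 = Y $ 1 $ 1 \<and> X $ 1 $ 2 = Y $ 1 $ 2
    \<and> X $ 2 $ 1 = Y $ 2 $ 1 \<and> X $ 2 $ 2 = Y $ 2 $ 2" for X Y :: "'a^2^2"
  by (auto simp: vec_eq_iff forall_2)

lemma matrix_mult_entry_2: "(X ** Y) $ i $ j = X $ i $ 1 * Y $ 1 $ j + X $ i $ 2 * Y $ 2 $ j"
  for X Y :: "'a::semiring_1^2^2"
  by (simp add: matrix_matrix_mult_def sum_2)

lemma trace_2: "trace X = X $ 1 $ 1 + X $ 2 $ 2" for X :: "'a::semiring_1^2^2"
  by (simp add: trace_def sum_2)

lemma matrix_inv_inverse: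
  assumes "invertible Y"
  shows matrix_inv_right: "Y ** matrix_inv Y = mat 1" and matrix_inv_left: "matrix_inv Y ** Y = mat 1"
  using someI_ex[OF assms[unfolded invertible_def]] by (simp_all add: matrix_inv_def)

text \<open>An intertwining equation is easier to compute with than an expression containing an
  inverse, since all its entries are polynomial.\<close>

lemma conj_class_iff_intertwined:
  "X \<in> conj_class B \<longleftrightarrow> (\<exists>Y. invertible Y \<and> Y ** X = B ** Y)"
proof
  assume "X \<in> conj_class B"
  then obtain Y where "invertible Y" "X = matrix_inv Y ** B ** Y"
    by (auto simp: conj_class_def)
  then show "\<exists>Y. invertible Y \<and> Y ** X = B ** Y"
    by (metis matrix_inv_right matrix_mul_assoc matrix_mul_lid)
next
  assume "\<exists>Y. invertible Y \<and> Y ** X = B ** Y"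
  then obtain Y where "invertible Y" "Y ** X = B ** Y"
    by blast
  then have "X = matrix_inv Y ** B ** Y"
    by (metis matrix_inv_left matrix_mul_assoc matrix_mul_lid)
  then show "X \<in> conj_class B"
    using \<open>invertible Y\<close> by (auto simp: conj_class_def)
qed

lemma conj_class_sym:
  assumes "X \<in> conj_class B"
  shows "B \<in> conj_class X"
proof -
  obtain Y where Y: "invertible Y" "Y ** X = B ** Y"
    using assms conj_class_iff_intertwined by blast
  have "matrix_inv Y ** B = X ** matrix_inv Y"
    by (metis Y matrix_inv_left matrix_inv_right matrix_mul_assoc matrix_mul_lid matrix_mul_rid)
  moreover have "invertible (matrix_inv Y)"
    by (metis Y(1) invertible_def matrix_inv_left matrix_inv_right)
  ultimately show ?thesis
    using conj_class_iff_intertwined by blast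
qed

lemma conj_class_trans:
  assumes "X \<in> conj_class B" "B \<in> conj_class C"
  shows "X \<in> conj_class C"
proof -
  obtain Y Z where "invertible Y" "Y ** X = B ** Y" "invertible Z" "Z ** B = C ** Z"
    using assms conj_class_iff_intertwined by blast
  then have "invertible (Z ** Y)" "(Z ** Y) ** X = C ** (Z ** Y)"
    by (simp add: invertible_mult) (metis \<open>Y ** X = B ** Y\<close> \<open>Z ** B = C ** Z\<close> matrix_mul_assoc)
  then show ?thesis
    using conj_class_iff_intertwined by blast
qed

lemma conj_class_imp_trace_det_eq:
  assumes "X \<in> conj_class B"
  shows "trace X = trace B" "det X = det B"
proof -
  obtain Y where Y: "invertible Y" "Y ** X = B ** Y"
    using assms conj_class_iff_intertwined by blast
  have X: "X = matrix_inv Y ** (B ** Y)"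
    by (metis Y matrix_inv_left matrix_mul_assoc matrix_mul_lid)
  have "trace X = trace ((B ** Y) ** matrix_inv Y)"
    unfolding X by (rule trace_mul_sym)
  also have "\<dots> = trace B"
    by (metis Y(1) matrix_inv_right matrix_mul_assoc matrix_mul_rid)
  finally show "trace X = trace B" .
  have "det Y * det X = det Y * det B"
    using arg_cong[OF Y(2), of det] by (simp add: det_mul)
  then show "det X = det B"
    using Y(1) by (simp add: invertible_det_nz)
qed

lemma conj_class_scalar: "conj_class (mat_D p p) = {mat_D p p}"
proof -
  have scalar_commutes: "mat_D p p ** Y = Y ** mat_D p p" for Y
    by (simp add: matrix_eq_2 matrix_mult_entry_2)
  have "X = mat_D p p" if "invertible Y" "Y ** X = mat_D p p ** Y" for X Y
    by (metis matrix_inv_left matrix_mul_assoc matrix_mul_lid scalar_commutes that)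
  then have "conj_class (mat_D p p) \<subseteq> {mat_D p p}"
    using conj_class_iff_intertwined by blast
  moreover have "mat_D p p \<in> conj_class (mat_D p p)"
    unfolding conj_class_iff_intertwined
    by (rule exI[of _ "mat 1"]) (simp add: invertible_det_nz)
  ultimately show ?thesis
    by blast
qed

definition companion_2 :: "real \<Rightarrow> real \<Rightarrow> real^2^2" where
  "companion_2 t d = vector [vector [0, 1], vector [- d, t]]"

text \<open>The conjugating matrix has rows \<open>v\<close> and \<open>v X\<close> for a cyclic row vector \<open>v\<close>. The
  determinant \<open>det (v, v X)\<close> is a quadratic form in \<open>v\<close>, whose coefficients are, up to sign, the
  off-diagonal entries and the difference of the diagonal entries of \<open>X\<close>, and it vanishes identically only
  when \<open>X\<close> is scalar.\<close>

lemma nonscalar_in_conj_class_companion: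
  assumes "\<And>p. X \<noteq> mat_D p p"
  shows "X \<in> conj_class (companion_2 (trace X) (det X))"
proof -
  have "X $ 1 $ 2 \<noteq> 0 \<or> X $ 2 $ 1 \<noteq> 0 \<or> X $ 1 $ 1 \<noteq> X $ 2 $ 2"
    using assms[of "X $ 1 $ 1"] by (auto simp: matrix_eq_2)
  then consider "X $ 1 $ 2 \<noteq> 0" | "X $ 2 $ 1 \<noteq> 0"
    | "X $ 1 $ 2 = 0" "X $ 2 $ 1 = 0" "X $ 1 $ 1 \<noteq> X $ 2 $ 2"
    by blast
  then obtain x y
    where cyclic: "x\<^sup>2 * X $ 1 $ 2 + x * y * (X $ 2 $ 2 - X $ 1 $ 1) - y\<^sup>2 * X $ 2 $ 1 \<noteq> 0"
  proof cases
    case 1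
    with that[of 1 0] show thesis by simp
  next
    case 2
    with that[of 0 1] show thesis by simp
  next
    case 3
    with that[of 1 1] show thesis by simp
  qed
  define Y :: "real^2^2" where
    "Y = vector [vector [x, y],
                 vector [x * X $ 1 $ 1 + y * X $ 2 $ 1, x * X $ 1 $ 2 + y * X $ 2 $ 2]]"
  have "det Y \<noteq> 0"
    using cyclic by (simp add: Y_def det_2 power2_eq_square algebra_simps)
  moreover have "Y ** X = companion_2 (trace X) (det X) ** Y"
    by (simp add: Y_def companion_2_def matrix_eq_2 matrix_mult_entry_2 trace_2 det_2 algebra_simps)
  ultimately show ?thesis
    using conj_class_iff_intertwined invertible_det_nz by blast
qed

lemma conj_class_nonscalar:
  assumes "\<And>p. B \<noteq> mat_D p p"
  shows "X \<in> conj_class B \<longleftrightarrow> (\<forall>p. X \<noteq> mat_D p p) \<and> trace X = trace B \<and> det X = det B"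
proof safe
  fix p
  assume "mat_D p p \<in> conj_class B"
  then show False
    using assms conj_class_sym conj_class_scalar by blast
next
  assume "\<forall>p. X \<noteq> mat_D p p" "trace X = trace B" "det X = det B"
  then show "X \<in> conj_class B"
    using nonscalar_in_conj_class_companion[of X] nonscalar_in_conj_class_companion[OF assms]
      conj_class_sym conj_class_trans by metis
qed (simp_all add: conj_class_imp_trace_det_eq)

section \<open>The representatives\<close>

definition normal_forms :: "(real^2^2) set" where
  "normal_forms = {mat_D p p |p. True} \<union> {mat_J p |p. True} \<union> {mat_D p q |p q. p < q}
     \<union> {mat_R u v |u v. v > 0}"

lemma nonscalar_mat:
  "mat_J p \<noteq> mat_D r r" "p < q \<Longrightarrow> mat_D p q \<noteq> mat_D r r" "v > 0 \<Longrightarrow> mat_R u v \<noteq> mat_D r r"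
  by (auto simp: matrix_eq_2)

lemma mat_trace:
  "trace (mat_D p q) = p + q" "trace (mat_J p) = 2 * p" "trace (mat_R u v) = 2 * u"
  by (simp_all add: trace_2)

lemma mat_det:
  "det (mat_D p q) = p * q" "det (mat_J p) = p\<^sup>2" "det (mat_R u v) = u\<^sup>2 + v\<^sup>2"
  by (simp_all add: det_2 power2_eq_square)

text \<open>For a non-scalar matrix it suffices to find a non-scalar representative with the same trace
  \<open>t\<close> and determinant \<open>d\<close>. Its parameters come from the roots of the characteristic polynomial
  \<open>x\<^sup>2 - t x + d\<close>, which are equal, real and distinct, or complex conjugate according to the sign
  of the discriminant.\<close>

lemma in_conj_class_normal_form: "\<exists>B\<in>normal_forms. X \<in> conj_class B"
proof (cases "\<exists>p. X = mat_D p p")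
  case True
  then obtain p where "X = mat_D p p"
    by blast
  then have "X \<in> conj_class (mat_D p p)" "mat_D p p \<in> normal_forms"
    by (auto simp: conj_class_scalar normal_forms_def)
  then show ?thesis
    by blast
next
  case nonscalar: False
  define t d where "t = trace X" and "d = det X"
  consider "t\<^sup>2 - 4 * d = 0" | "t\<^sup>2 - 4 * d > 0" | "t\<^sup>2 - 4 * d < 0"
    by linarith
  then obtain B where "B \<in> normal_forms" "\<And>p. B \<noteq> mat_D p p" "trace B = t" "det B = d"
  proof cases
    case 1
    show thesis
    proof (rule that[of "mat_J (t / 2)"])
      show "det (mat_J (t / 2)) = d"
        using 1 by (simp add: mat_det power_divide)
    qed (auto simp: normal_forms_def nonscalar_mat mat_trace)
  next
    case 2
    define s where "s = sqrt (t\<^sup>2 - 4 * d)"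
    have s: "s > 0" "s * s = t * t - 4 * d"
      using 2 by (simp_all add: s_def flip: power2_eq_square)
    show thesis
    proof (rule that[of "mat_D ((t - s) / 2) ((t + s) / 2)"])
      show "det (mat_D ((t - s) / 2) ((t + s) / 2)) = d"
        using s(2) by (simp add: mat_det field_simps)
      have "(t - s) / 2 < (t + s) / 2"
        using s(1) by simp
      then show "mat_D ((t - s) / 2) ((t + s) / 2) \<in> normal_forms"
          "\<And>p. mat_D ((t - s) / 2) ((t + s) / 2) \<noteq> mat_D p p"
        unfolding normal_forms_def using nonscalar_mat(2) by blast+
    qed (simp add: mat_trace field_simps)
  next
    case 3
    define s where "s = sqrt (4 * d - t\<^sup>2)"
    have s: "s > 0" "s\<^sup>2 = 4 * d - t\<^sup>2"
      using 3 by (simp_all add: s_def)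
    show thesis
    proof (rule that[of "mat_R (t / 2) (s / 2)"])
      show "det (mat_R (t / 2) (s / 2)) = d"
        using s(2) by (simp add: mat_det power_divide field_simps)
      have "s / 2 > 0"
        using s(1) by simp
      then show "mat_R (t / 2) (s / 2) \<in> normal_forms" "\<And>p. mat_R (t / 2) (s / 2) \<noteq> mat_D p p"
        unfolding normal_forms_def using nonscalar_mat(3) by blast+
    qed (simp add: mat_trace)
  qed
  then show ?thesis
    using conj_class_nonscalar[of B X] nonscalar t_def d_def by auto
qed

lemma normal_form_cases:
  assumes "B \<in> normal_forms"
  obtains (scalar) p where "B = mat_D p p"
    | (jordan) p where "B = mat_J p" "(trace B)\<^sup>2 - 4 * det B = 0"
    | (diagonal) p q where "B = mat_D p q" "p < q" "(trace B)\<^sup>2 - 4 * det B = (q - p)\<^sup>2"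
    | (rotation) u v where "B = mat_R u v" "v > 0" "(trace B)\<^sup>2 - 4 * det B = - (2 * v)\<^sup>2"
proof -
  have "(trace (mat_J p))\<^sup>2 - 4 * det (mat_J p) = 0"
    "(trace (mat_D p q))\<^sup>2 - 4 * det (mat_D p q) = (q - p)\<^sup>2"
    "(trace (mat_R u v))\<^sup>2 - 4 * det (mat_R u v) = - (2 * v)\<^sup>2" for p q u v
    by (simp_all add: mat_trace mat_det power2_eq_square algebra_simps)
  then show ?thesis
    using assms that unfolding normal_forms_def by blast
qed

text \<open>For non-scalar representatives the sign of the discriminant gives the type, the
  discriminant and the trace then give the parameters.\<close>

lemma normal_form_unique:
  assumes "B \<in> normal_forms" "C \<in> normal_forms" "B \<in> conj_class C"
  shows "B = C"
proof (cases "\<exists>p. B = mat_D p p \<or> C = mat_D p p")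
  case True
  then show ?thesis
    using assms(3) conj_class_sym[OF assms(3)] by (auto simp: conj_class_scalar)
next
  case nonscalar: False
  have eq: "trace B = trace C" "(trace B)\<^sup>2 - 4 * det B = (trace C)\<^sup>2 - 4 * det C"
    using conj_class_imp_trace_det_eq[OF assms(3)] by simp_all
  have pos: "(q - p)\<^sup>2 > 0" if "p < q" for p q :: real
    using that by simp
  have neg: "- (2 * v)\<^sup>2 < 0" if "v > 0" for v :: real
    using that by simp
  show ?thesis
    using assms(1)
  proof (cases rule: normal_form_cases)
    case (scalar p)
    then show ?thesis using nonscalar by blast
  next
    case B: (jordan p)
    show ?thesis
      using assms(2)
    proof (cases rule: normal_form_cases)
      case (jordan p')
      then show ?thesis using B(1) eq(1) by (simp add: mat_trace)
    next
      case (diagonal p' q')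
      then show ?thesis using B(2) eq(2) pos[of p' q'] by linarith
    next
      case (rotation u v)
      then show ?thesis using B(2) eq(2) neg[of v] by linarith
    qed (use nonscalar in blast)
  next
    case B: (diagonal p q)
    show ?thesis
      using assms(2)
    proof (cases rule: normal_form_cases)
      case C: (diagonal p' q')
      have "p + q = p' + q'"
        using B(1) C(1) eq(1) by (simp add: mat_trace)
      moreover have "q - p = q' - p'"
      proof (rule power2_eq_imp_eq)
        show "(q - p)\<^sup>2 = (q' - p')\<^sup>2"
          using eq(2) B(3) C(3) by linarith
      qed (use B(2) C(2) in simp_all)
      ultimately show ?thesis
        using B(1) C(1) by (simp add: mat_inject)
    next
      case (jordan p')
      then show ?thesis using B(3) eq(2) pos[OF B(2)] by linarith
    next
      case (rotation u v)
      then show ?thesis using B(3) eq(2) pos[OF B(2)] neg[of v] by linarith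
    qed (use nonscalar in blast)
  next
    case B: (rotation u v)
    show ?thesis
      using assms(2)
    proof (cases rule: normal_form_cases)
      case C: (rotation u' v')
      have "2 * v = 2 * v'"
      proof (rule power2_eq_imp_eq)
        show "(2 * v)\<^sup>2 = (2 * v')\<^sup>2"
          using eq(2) B(3) C(3) by linarith
      qed (use B(2) C(2) in simp_all)
      then show ?thesis
        using B(1) C(1) eq(1) by (simp add: mat_trace)
    next
      case (jordan p')
      then show ?thesis using B(3) eq(2) neg[OF B(2)] by linarith
    next
      case (diagonal p' q')
      then show ?thesis using B(3) eq(2) pos[of p' q'] neg[OF B(2)] by linarith
    qed (use nonscalar in blast)
  qed
qed

lemma disjoint_family_on_normal_forms: "disjoint_family_on conj_class normal_forms"
  unfolding disjoint_family_on_def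
  using normal_form_unique conj_class_sym conj_class_trans by blast

section \<open>Polynomials evaluated at matrices\<close>

definition matrix_poly :: "real poly \<Rightarrow> real^2^2 \<Rightarrow> real^2^2" where
  "matrix_poly f X = (\<Sum>i\<le>degree f. coeff f i *\<^sub>R matrix_pow X i)"

lemma matrix_poly_entry:
  "matrix_poly f X $ i $ j = (\<Sum>k\<le>degree f. coeff f k * matrix_pow X k $ i $ j)"
  by (simp add: matrix_poly_def)

lemma matrix_pow_intertwined:
  assumes "Y ** X = B ** Y"
  shows "Y ** matrix_pow X k = matrix_pow B k ** Y"
proof (induction k)
  case (Suc k)
  then show ?case
    by (metis assms matrix_mul_assoc matrix_pow.simps(2))
qed simp

lemma matrix_poly_intertwined:
  assumes "Y ** X = B ** Y"
  shows "Y ** matrix_poly f X = matrix_poly f B ** Y"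
proof -
  have left: "(Y ** matrix_poly f X) $ i $ j
      = (\<Sum>k\<le>degree f. coeff f k * (Y ** matrix_pow X k) $ i $ j)" for i j
    by (simp add: matrix_mult_entry_2 matrix_poly_entry sum_distrib_left algebra_simps
        flip: sum.distrib)
  have right: "(matrix_poly f B ** Y) $ i $ j
      = (\<Sum>k\<le>degree f. coeff f k * (matrix_pow B k ** Y) $ i $ j)" for i j
    by (simp add: matrix_mult_entry_2 matrix_poly_entry sum_distrib_left algebra_simps
        flip: sum.distrib)
  show ?thesis
    by (simp add: vec_eq_iff left right matrix_pow_intertwined[OF assms])
qed

lemma matrix_poly_eq_0_conj_class:
  assumes "X \<in> conj_class B"
  shows "matrix_poly f X = 0 \<longleftrightarrow> matrix_poly f B = 0"
proof -
  have "matrix_poly f C = 0" if conj: "C \<in> conj_class A" and zero: "matrix_poly f A = 0" for A C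
  proof -
    obtain Y where Y: "invertible Y" "Y ** C = A ** Y"
      using conj conj_class_iff_intertwined by blast
    have "matrix_poly f C = matrix_inv Y ** (Y ** matrix_poly f C)"
      by (simp add: matrix_mul_assoc matrix_inv_left[OF Y(1)])
    also have "\<dots> = matrix_inv Y ** (0 ** Y)"
      by (simp only: matrix_poly_intertwined[OF Y(2)] zero)
    finally show ?thesis
      by (simp add: matrix_eq_2 matrix_mult_entry_2)
  qed
  then show ?thesis
    using assms conj_class_sym[OF assms] by blast
qed

lemma matrix_poly_mat_D: "matrix_poly f (mat_D p q) = mat_D (poly f p) (poly f q)"
proof -
  have "matrix_pow (mat_D p q) k = mat_D (p ^ k) (q ^ k)" for k
    by (induction k) (simp_all add: matrix_eq_2 matrix_mult_entry_2 mat_def)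
  then show ?thesis
    by (simp add: matrix_eq_2 matrix_poly_entry poly_altdef)
qed

lemma poly_pderiv_altdef: "poly (pderiv f) x = (\<Sum>i\<le>degree f. coeff f i * (of_nat i * x ^ (i - 1)))"
  for f :: "'a::{comm_ring_1,semiring_no_zero_divisors} poly"
proof -
  have "pderiv f = pderiv (\<Sum>i\<le>degree f. monom (coeff f i) i)"
    by (simp add: poly_as_sum_of_monoms)
  also have "\<dots> = (\<Sum>i\<le>degree f. monom (of_nat i * coeff f i) (i - 1))"
    by (simp add: higher_pderiv_sum[of 1, simplified] pderiv_monom)
  finally show ?thesis
    by (simp add: poly_sum poly_monom algebra_simps)
qed

text \<open>Write \<open>J(p) = p I + N\<close> with \<open>N\<^sup>2 = 0\<close>: the Taylor expansion of \<open>f\<close> at \<open>p\<close> stops after the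
  linear term, so that \<open>f(J(p)) = f(p) I + f'(p) N\<close>.\<close>

lemma matrix_poly_mat_J:
  "matrix_poly f (mat_J p) = vector [vector [poly f p, poly (pderiv f) p], vector [0, poly f p]]"
proof -
  have "matrix_pow (mat_J p) k $ 1 $ 1 = p ^ k \<and> matrix_pow (mat_J p) k $ 1 $ 2 = k * p ^ (k - 1)
    \<and> matrix_pow (mat_J p) k $ 2 $ 1 = 0 \<and> matrix_pow (mat_J p) k $ 2 $ 2 = p ^ k" for k
  proof (induction k)
    case (Suc k)
    then show ?case
      by (cases k) (simp_all add: matrix_mult_entry_2 algebra_simps)
  qed (simp add: mat_def)
  then show ?thesis
    by (simp add: matrix_eq_2 matrix_poly_entry poly_altdef[of f] poly_pderiv_altdef)
qed

text \<open>Sending \<open>u + iv\<close> to \<open>R(u,v)\<close> embeds the complex numbers into the matrices as a real algebra,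
  hence commutes with the evaluation of real polynomials.\<close>

lemma matrix_poly_mat_R:
  fixes f :: "real poly"
  defines "w \<equiv> \<lambda>z. poly (map_poly complex_of_real f) z"
  shows "matrix_poly f (mat_R u v) = mat_R (Re (w (Complex u v))) (Im (w (Complex u v)))"
proof -
  define z where "z = Complex u v"
  have pow: "matrix_pow (mat_R u v) k = mat_R (Re (z ^ k)) (Im (z ^ k))" for k
    by (induction k) (simp_all add: matrix_eq_2 matrix_mult_entry_2 mat_def z_def algebra_simps)
  have "w z = (\<Sum>k\<le>degree f. complex_of_real (coeff f k) * z ^ k)"
    by (simp add: w_def poly_altdef degree_map_poly coeff_map_poly)
  then show ?thesis
    by (simp add: matrix_eq_2 matrix_poly_entry pow z_def sum_negf)
qed

lemma order_ge_2_iff: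
  fixes f :: "'a::field_char_0 poly"
  assumes "degree f > 0" "poly f p = 0"
  shows "order p f \<ge> 2 \<longleftrightarrow> poly (pderiv f) p = 0"
proof -
  have nz: "f \<noteq> 0" "pderiv f \<noteq> 0"
    using assms(1) by (auto simp: pderiv_eq_0_iff)
  have "order p f = Suc (order p (pderiv f))"
    using assms(2) nz by (intro order_pderiv) (auto simp: order_root)
  then show ?thesis
    using nz(2) by (simp add: order_root Suc_le_eq)
qed

section \<open>Solutions of the matrix equation\<close>

lemma monic_poly_coeff: "coeff (monic_poly n a) i = (if i = n then 1 else if i < n then a i else 0)"
  by (simp add: monic_poly_def coeff_sum)

lemma degree_monic_poly: "degree (monic_poly n a) = n"
proof (rule antisym)
  show "degree (monic_poly n a) \<le> n"
    by (intro degree_le) (simp add: monic_poly_coeff)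
  show "n \<le> degree (monic_poly n a)"
    by (intro le_degree) (simp add: monic_poly_coeff)
qed

lemma matrix_solutions_altdef: "matrix_solutions n a = {X. matrix_poly (monic_poly n a) X = 0}"
proof -
  have "matrix_poly (monic_poly n a) X = matrix_pow X n + (\<Sum>i<n. a i *\<^sub>R matrix_pow X i)" for X
    by (simp add: matrix_poly_def degree_monic_poly monic_poly_coeff flip: lessThan_Suc_atMost)
  then show ?thesis
    by (simp add: matrix_solutions_def)
qed

theorem theorem3p4:
  fixes n :: nat and a :: "nat \<Rightarrow> real"
  assumes "n \<ge> 2"
  shows "let f = monic_poly n a;
             T = {mat_D p p |p. poly f p = 0}
               \<union> {mat_J p |p. poly f p = 0 \<and> order p f \<ge> 2}
               \<union> {mat_D p q |p q. p < q \<and> poly f p = 0 \<and> poly f q = 0}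
               \<union> {mat_R u v |u v. v > 0 \<and> poly (map_poly complex_of_real f) (Complex u v) = 0}
         in matrix_solutions n a = (\<Union>B\<in>T. conj_class B) \<and> disjoint_family_on conj_class T"
proof -
  define f where "f = monic_poly n a"
  have annihilated:
    "matrix_poly f (mat_D p q) = 0 \<longleftrightarrow> poly f p = 0 \<and> poly f q = 0"
    "matrix_poly f (mat_J p) = 0 \<longleftrightarrow> poly f p = 0 \<and> order p f \<ge> 2"
    "matrix_poly f (mat_R u v) = 0 \<longleftrightarrow> poly (map_poly complex_of_real f) (Complex u v) = 0"
    for p q u v
  proof -
    show "matrix_poly f (mat_D p q) = 0 \<longleftrightarrow> poly f p = 0 \<and> poly f q = 0"
      by (auto simp: matrix_poly_mat_D matrix_eq_2)
    have "degree f > 0"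
      using assms by (simp add: f_def degree_monic_poly)
    then show "matrix_poly f (mat_J p) = 0 \<longleftrightarrow> poly f p = 0 \<and> order p f \<ge> 2"
      using order_ge_2_iff[of f p] by (auto simp: matrix_poly_mat_J matrix_eq_2)
    show "matrix_poly f (mat_R u v) = 0 \<longleftrightarrow> poly (map_poly complex_of_real f) (Complex u v) = 0"
      by (auto simp: matrix_poly_mat_R matrix_eq_2 complex_eq_iff)
  qed
  define T where "T = {mat_D p p |p. poly f p = 0}
    \<union> {mat_J p |p. poly f p = 0 \<and> order p f \<ge> 2}
    \<union> {mat_D p q |p q. p < q \<and> poly f p = 0 \<and> poly f q = 0}
    \<union> {mat_R u v |u v. v > 0 \<and> poly (map_poly complex_of_real f) (Complex u v) = 0}"
  have T: "T = {B \<in> normal_forms. matrix_poly f B = 0}"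
    unfolding T_def normal_forms_def using annihilated by auto
  have "matrix_solutions n a = (\<Union>B\<in>T. conj_class B)"
  proof (intro set_eqI)
    fix X
    have "matrix_poly f X = 0 \<longleftrightarrow> (\<exists>B\<in>normal_forms. X \<in> conj_class B \<and> matrix_poly f B = 0)"
      using in_conj_class_normal_form matrix_poly_eq_0_conj_class by blast
    then show "X \<in> matrix_solutions n a \<longleftrightarrow> X \<in> (\<Union>B\<in>T. conj_class B)"
      by (auto simp: matrix_solutions_altdef T f_def)
  qed
  moreover have "disjoint_family_on conj_class T"
    by (rule disjoint_family_on_mono[OF _ disjoint_family_on_normal_forms]) (auto simp: T)
  ultimately show ?thesis
    unfolding f_def T_def Let_def by blast
qed

end
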